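(* Let $F,G\in\mathbb{C}^{r\times m}$ be such that the pencil $sF-G$ is singular with $\dim\mathcal{N}_r(sF-G)=0$, let $A,B\in\mathbb{C}^{n\times m}$, $D\in\mathbb{C}^{n\times1}$, and let $k_0\le k_N$ be natural numbers. Consider the boundary value problem of finding $(Y_k)_{k\ge k_0}$ in $\mathbb{C}^{m\times1}$ with $$FY_{k+1}=GY_k\quad(k\ge k_0),\qquad AY_{k_0}+BY_{k_N}=D.$$ Let $J_p\in\mathbb{C}^{p\times p}$, $Q_p\in\mathbb{C}^{m\times p}$ be the matrices associated with the Kronecker canonical form of $sF-G$ (see context), assume $\|J_p\|<1$ for an induced matrix norm $\|\cdot\|$, and put $K=AQ_p+BQ_pJ_p^{k_N-k_0}\in\mathbb{C}^{n\times p}$. Suppose the boundary value problem is consistent and has infinitely many solutions. Then: (a) If $K^\dagger$ is the Moore–Penrose pseudoinverse of $K$, an optimal solution of the boundary value problem is $$\hat Y_k=Q_pJ_p^{k-k_0}K^\dagger D;$$ that is, $\hat Y_k=Q_pJ_p^{k-k_0}\hat C$, where $\hat C=K^\dagger D$ is a solution of $KC=D$ of minimum Euclidean norm. (b) If $p>n$ and $K$ has full rank, a minimum solution of the boundary value problem is $$\hat Y_k=Q_pJ_p^{k-k_0}K^*(KK^* )^{-1}D;$$ that is, $\hat Y_k=Q_pJ_p^{k-k_0}\hat C$, where $\hat C=K^*(KK^* )^{-1}D$ minimizes $\|C\|_2^2$ subject to $KC=D$. (c) If $D\in\operatorname{colspan}K$ and $K$ is rank deficient, and $E$ is a matrix with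 $p$ columns such that $K^*K+E^*E$ is invertible and $\|E\|_2=\theta$ with $0<\theta\ll1$, then an optimal solution of the boundary value problem, in the regularized least squares sense, is $$\hat Y_k=Q_pJ_p^{k-k_0}(K^*K+E^*E)^{-1}K^*D;$$ that is, $\hat Y_k=Q_pJ_p^{k-k_0}\hat C$, where $\hat C=(K^*K+E^*E)^{-1}K^*D$ minimizes $\|D-KC\|_2^2+\|EC\|_2^2$ over $C\in\mathbb{C}^{p\times1}$.
   Context: A pencil $sF-G$ with $F,G\in\mathbb{C}^{r\times m}$ is called singular if $r\ne m$, or $r=m$ and $\det(sF-G)\equiv0$. $\mathcal{N}_r(sF-G)$ is the right null space $\{U(s):(sF-G)U(s)=0\}$ as a vector space over the field of rational functions $\mathbb{C}(s)$; the assumption $\dim\mathcal{N}_r(sF-G)=0$ means that there are no column minimal indices (the degrees of a minimal polynomial basis of $\mathcal{N}_r$). Let $0=\zeta_1=\dots=\zeta_h<\zeta_{h+1}\le\dots\le\zeta_t$ be the row minimal indices (degrees of a minimal polynomial basis of the left null space). Kronecker canonical form in this case: there are non-singular $P\in\mathbb{C}^{r\times r}$, $Q\in\mathbb{C}^{m\times m}$ with $$PFQ=I_p\oplus H_q\oplus F_\zeta\oplus0_{h,0},\qquad PGQ=J_p\oplus I_q\oplus G_\zeta\oplus0_{h,0},$$ where $\oplus$ is the block diagonal sum (blocks may be empty; $0_{h,0}$ stands for $h$ zero rows), $J_p\in\mathbb{C}^{p\times p}$ is the Jordan matrix given by the finite elementary divisors $(s-a_j)^{p_j}$, $\sum_j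 p_j=p$, $H_q$ is the direct sum of nilpotent Jordan blocks given by the infinite elementary divisors, and $F_\zeta$, $G_\zeta$ are block diagonal with respective blocks $\begin{bmatrix} I_{\zeta_j} \\ 0_{1,\zeta_j} \end{bmatrix}$, $\begin{bmatrix} 0_{1,\zeta_j} \\ I_{\zeta_j} \end{bmatrix}$, $j=h+1,\dots,t$. Partition $Q=[\,Q_p\ Q_q\ Q_\zeta\,]$ conformally; $Q_p\in\mathbb{C}^{m\times p}$ consists of the first $p$ columns of $Q$. The boundary value problem is consistent if it has at least one solution. $\operatorname{colspan}$ is the column space, $(\cdot)^*$ the conjugate transpose, and $\|\cdot\|_2$ the Euclidean norm (for matrices, the norm induced by it). $K$ is rank deficient if its rank is less than $\min(n,p)$. The notation $0<\theta\ll1$ means that $\theta$ is a (small) real number with $0<\theta<1$. By convention $J_p^0=I_p$. *)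

theory Defs
  imports
    "HOL-Analysis.L2_Norm"
    "Jordan_Normal_Form.Matrix_Kernel"
    "Jordan_Normal_Form.Jordan_Normal_Form"
    "Jordan_Normal_Form.Schur_Decomposition"
    "Jordan_Normal_Form.Gauss_Jordan_Elimination"
    "Jordan_Normal_Form.DL_Rank"
begin

section \<open>Matrix pencils\<close>

definition pencil :: "complex mat \<Rightarrow> complex mat \<Rightarrow> complex poly mat" where
  "pencil F G = [:0, 1:] \<cdot>\<^sub>m map_mat (\<lambda>a. [:a:]) F - map_mat (\<lambda>a. [:a:]) G"

definition singular_pencil :: "complex mat \<Rightarrow> complex mat \<Rightarrow> bool" where
  "singular_pencil F G \<longleftrightarrow> dim_row F \<noteq> dim_col F \<or> det (pencil F G) = 0"

text \<open>The rational functions \<open>\<complex>(s)\<close> are the fraction field \<^typ>\<open>complex poly fract\<close>.\<close>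

definition right_null_dim :: "complex mat \<Rightarrow> complex mat \<Rightarrow> nat" where
  "right_null_dim F G = kernel_dim (map_mat to_fract (pencil F G))"

definition F_zeta :: "nat list \<Rightarrow> complex mat" where
  "F_zeta zs = diag_block_mat (map (\<lambda>z. 1\<^sub>m z @\<^sub>r 0\<^sub>m 1 z) zs)"

definition G_zeta :: "nat list \<Rightarrow> complex mat" where
  "G_zeta zs = diag_block_mat (map (\<lambda>z. 0\<^sub>m 1 z @\<^sub>r 1\<^sub>m z) zs)"

text \<open>
  Kronecker canonical form of a pencil without column minimal indices.
  \<open>js\<close> lists the finite elementary divisors \<open>(s - a)^k\<close> as pairs \<open>(k, a)\<close>,
  \<open>qs\<close> the degrees of the infinite elementary divisors, \<open>zs\<close> the nonzero row minimal
  indices, and \<open>h\<close> is the number of zero row minimal indices. That these data are the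
  invariants of the pencil follows from the two equations, the diagonal blocks being
  preserved up to order under strict equivalence.
\<close>

definition kronecker_form ::
  "complex mat \<Rightarrow> complex mat \<Rightarrow> complex mat \<Rightarrow> complex mat \<Rightarrow>
   (nat \<times> complex) list \<Rightarrow> nat list \<Rightarrow> nat list \<Rightarrow> nat \<Rightarrow> bool" where
  "kronecker_form F G P Q js qs zs h \<longleftrightarrow>
     P \<in> carrier_mat (dim_row F) (dim_row F) \<and> invertible_mat P \<and>
     Q \<in> carrier_mat (dim_col F) (dim_col F) \<and> invertible_mat Q \<and>
     0 \<notin> fst ` set js \<and> 0 \<notin> set qs \<and> 0 \<notin> set zs \<and> sorted zs \<and>
     P * F * Q = diag_block_mat
       [1\<^sub>m (sum_list (map fst js)), jordan_matrix (map (\<lambda>k. (k, 0)) qs), F_zeta zs, 0\<^sub>m h 0] \<and>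
     P * G * Q = diag_block_mat
       [jordan_matrix js, 1\<^sub>m (sum_list qs), G_zeta zs, 0\<^sub>m h 0]"

definition first_cols :: "nat \<Rightarrow> 'a mat \<Rightarrow> 'a mat" where
  "first_cols p Q = mat (dim_row Q) p (\<lambda>(i, j). Q $$ (i, j))"

section \<open>Norms, inverses and pseudoinverses\<close>

definition vec_norm_on :: "nat \<Rightarrow> (complex vec \<Rightarrow> real) \<Rightarrow> bool" where
  "vec_norm_on n \<nu> \<longleftrightarrow>
     (\<forall>x\<in>carrier_vec n. 0 \<le> \<nu> x \<and> (\<nu> x = 0 \<longleftrightarrow> x = 0\<^sub>v n)) \<and>
     (\<forall>x\<in>carrier_vec n. \<forall>c. \<nu> (c \<cdot>\<^sub>v x) = cmod c * \<nu> x) \<and>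
     (\<forall>x\<in>carrier_vec n. \<forall>y\<in>carrier_vec n. \<nu> (x + y) \<le> \<nu> x + \<nu> y)"

definition induced_norm :: "(complex vec \<Rightarrow> real) \<Rightarrow> complex mat \<Rightarrow> real" where
  "induced_norm \<nu> M = (SUP x \<in> {x \<in> carrier_vec (dim_col M). \<nu> x \<le> 1}. \<nu> (M *\<^sub>v x))"

definition norm2 :: "complex vec \<Rightarrow> real" where
  "norm2 x = L2_set (\<lambda>i. cmod (x $ i)) {..<dim_vec x}"

text \<open>Only meaningful for invertible arguments.\<close>

definition inv_mat :: "complex mat \<Rightarrow> complex mat" where
  "inv_mat M = the (mat_inverse M)"

text \<open>The four Penrose equations.\<close>

definition moore_penrose :: "complex mat \<Rightarrow> complex mat \<Rightarrow> bool" where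
  "moore_penrose K X \<longleftrightarrow>
     X \<in> carrier_mat (dim_col K) (dim_row K) \<and>
     K * X * K = K \<and> X * K * X = X \<and>
     mat_adjoint (K * X) = K * X \<and> mat_adjoint (X * K) = X * K"

section \<open>The boundary value problem\<close>

text \<open>
  A sequence \<open>(Y\<^sub>k)\<close> indexed by \<open>k \<ge> k0\<close> is an extensional function on \<open>{k0..}\<close>, so that
  distinct functions are distinct sequences and counting solutions makes sense.
\<close>

definition system_solutions ::
  "complex mat \<Rightarrow> complex mat \<Rightarrow> nat \<Rightarrow> (nat \<Rightarrow> complex vec) set" where
  "system_solutions F G k0 =
     {Y \<in> {k0..} \<rightarrow>\<^sub>E carrier_vec (dim_col F). \<forall>k\<ge>k0. F *\<^sub>v Y (Suc k) = G *\<^sub>v Y k}"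

definition bvp_solutions ::
  "complex mat \<Rightarrow> complex mat \<Rightarrow> complex mat \<Rightarrow> complex mat \<Rightarrow> complex vec \<Rightarrow>
   nat \<Rightarrow> nat \<Rightarrow> (nat \<Rightarrow> complex vec) set" where
  "bvp_solutions F G A B D k0 kN =
     {Y \<in> system_solutions F G k0. A *\<^sub>v Y k0 + B *\<^sub>v Y kN = D}"

definition trajectory ::
  "complex mat \<Rightarrow> complex mat \<Rightarrow> nat \<Rightarrow> complex vec \<Rightarrow> nat \<Rightarrow> complex vec" where
  "trajectory Qp Jp k0 C = (\<lambda>k\<in>{k0..}. (Qp * Jp ^\<^sub>m (k - k0)) *\<^sub>v C)"

text \<open>
  \<open>Y\<close> belongs to the set \<open>S\<close> of admissible sequences, and among all of \<open>S\<close> its coefficient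
  vector \<open>C\<close> in \<open>Y\<^sub>k = Q\<^sub>p J\<^sub>p\<^sup>(\<^sup>k\<^sup>-\<^sup>k\<^sup>0\<^sup>) C\<close> has the least cost. The definition requires every
  element of \<open>S\<close> to be of that form.
\<close>

definition optimal_in ::
  "complex mat \<Rightarrow> complex mat \<Rightarrow> nat \<Rightarrow> (complex vec \<Rightarrow> real) \<Rightarrow>
   (nat \<Rightarrow> complex vec) set \<Rightarrow> (nat \<Rightarrow> complex vec) \<Rightarrow> bool" where
  "optimal_in Qp Jp k0 cost S Y \<longleftrightarrow> Y \<in> S \<and>
     (\<exists>C\<in>carrier_vec (dim_col Qp). Y = trajectory Qp Jp k0 C \<and>
        (\<forall>Y'\<in>S. \<exists>C'\<in>carrier_vec (dim_col Qp).
           Y' = trajectory Qp Jp k0 C' \<and> cost C \<le> cost C'))"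

end

theory Submission
  imports Defs
begin

text \<open>
  The Kronecker form decouples the system. With \<open>Y\<^sub>k = Q Z\<^sub>k\<close>, multiplying \<open>F Y\<^sub>k\<^sub>+\<^sub>1 = G Y\<^sub>k\<close>
  by the invertible \<open>P\<close> gives one independent recursion per diagonal block. The first block reads
  \<open>Z\<^sub>k\<^sub>+\<^sub>1 = J\<^sub>p Z\<^sub>k\<close>, so its solutions are \<open>J\<^sub>p\<^sup>k\<^sup>-\<^sup>k\<^sup>0 C\<close> with \<open>C\<close> arbitrary. Every other block
  admits only the zero solution: a nilpotent Jordan block and a block of a row minimal index both
  force each entry at time \<open>k\<close> to equal the next entry at time \<open>k + 1\<close>, and the last entry to
  vanish at all times; following the entries to the end of the block yields zero. The block
  \<open>0\<^sub>h\<^sub>,\<^sub>0\<close> has no unknowns. Hence the solutions of the system are exactly the trajectories \<open>Q\<^sub>p J\<^sub>p\<^sup>k\<^sup>-\<^sup>k\<^sup>0 C\<close>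
  (\<open>kronecker_form_solutions\<close>), and the boundary condition becomes the linear system \<open>K C = D\<close>
  (\<open>bvp_solutions_eq_trajectories\<close>), which is solvable because the boundary value problem is
  consistent.

  What remains is least squares for \<open>K C = D\<close>. Two solutions differ by an element of the kernel of
  \<open>K\<close>, which is orthogonal to the range of \<open>K\<^sup>*\<close>; so by Pythagoras a solution of the form \<open>K\<^sup>* y\<close> has
  minimum norm (\<open>norm2_le_of_range_adjoint\<close>). The Penrose equations put \<open>K\<^sup>\<dagger> D\<close> in this range, and
  \<open>K\<^sup>* (K K\<^sup>*)\<^sup>-\<^sup>1 D\<close> is visibly of this form, where \<open>K K\<^sup>*\<close> is invertible because a \<open>K\<close> of full row
  rank is surjective. For the regularized problem, a vector that satisfies the normal equations is
  a stationary point of a convex quadratic cost, hence a minimizer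
  (\<open>regularized_least_squares_minimum\<close>).
\<close>

section \<open>Least squares in finite-dimensional Hermitian space\<close>

lemma dim_mat_adjoint [simp]:
  "dim_row (mat_adjoint A) = dim_col A" "dim_col (mat_adjoint A) = dim_row A"
  unfolding mat_adjoint_def by auto

lemma mat_adjoint_carrier [intro]:
  "A \<in> carrier_mat m n \<Longrightarrow> mat_adjoint A \<in> carrier_mat n m"
  by (rule carrier_matI) auto

lemma mat_adjoint_index:
  assumes "i < dim_col A" "j < dim_row A"
  shows "mat_adjoint A $$ (i, j) = conjugate (A $$ (j, i))"
  using assms by (simp add: mat_adjoint_def mat_of_rows_def)

lemma mat_adjoint_mult:
  fixes A B :: "complex mat"
  assumes A: "A \<in> carrier_mat m n" and B: "B \<in> carrier_mat n l"
  shows "mat_adjoint (A * B) = mat_adjoint B * mat_adjoint A"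
proof (rule eq_matI)
  show "dim_row (mat_adjoint (A * B)) = dim_row (mat_adjoint B * mat_adjoint A)"
    "dim_col (mat_adjoint (A * B)) = dim_col (mat_adjoint B * mat_adjoint A)"
    by simp_all
  fix i j
  assume "i < dim_row (mat_adjoint B * mat_adjoint A)" "j < dim_col (mat_adjoint B * mat_adjoint A)"
  then have "i < l" "j < m" using A B by auto
  then show "mat_adjoint (A * B) $$ (i, j) = (mat_adjoint B * mat_adjoint A) $$ (i, j)"
    using A B by (auto simp: mat_adjoint_index scalar_prod_def intro!: sum.cong)
qed

lemma cscalar_prod_adjoint:
  fixes A :: "complex mat"
  assumes A: "A \<in> carrier_mat m n" and x: "x \<in> carrier_vec n" and y: "y \<in> carrier_vec m"
  shows "(A *\<^sub>v x) \<bullet>c y = x \<bullet>c (mat_adjoint A *\<^sub>v y)"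
proof -
  have "(A *\<^sub>v x) \<bullet>c y = (\<Sum>i<m. \<Sum>j<n. A $$ (i, j) * x $ j * cnj (y $ i))"
    using A x y by (simp add: scalar_prod_def sum_distrib_right atLeast0LessThan)
  also have "\<dots> = (\<Sum>j<n. \<Sum>i<m. A $$ (i, j) * x $ j * cnj (y $ i))"
    by (rule sum.swap)
  also have "\<dots> = x \<bullet>c (mat_adjoint A *\<^sub>v y)"
    using A x y
    by (auto simp: scalar_prod_def sum_distrib_left atLeast0LessThan mat_adjoint_index
        algebra_simps intro!: sum.cong)
  finally show ?thesis .
qed

lemma norm2_nonneg: "0 \<le> norm2 x"
  unfolding norm2_def by (rule L2_set_nonneg)

lemma norm2_sq: "(norm2 x)\<^sup>2 = (\<Sum>i<dim_vec x. (cmod (x $ i))\<^sup>2)"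
  unfolding norm2_def L2_set_def by (rule real_sqrt_pow2) (rule sum_nonneg, simp)

lemma norm2_sq_add:
  assumes "x \<in> carrier_vec n" "y \<in> carrier_vec n"
  shows "(norm2 (x + y))\<^sup>2 = (norm2 x)\<^sup>2 + (norm2 y)\<^sup>2 + 2 * Re (x \<bullet>c y)"
proof -
  have "(cmod (a + b))\<^sup>2 = (cmod a)\<^sup>2 + (cmod b)\<^sup>2 + 2 * Re (a * cnj b)" for a b
    unfolding cmod_power2 by (simp add: power2_eq_square algebra_simps)
  then show ?thesis
    using assms
    by (simp add: norm2_sq scalar_prod_def sum.distrib sum_distrib_left atLeast0LessThan)
qed

text \<open>
  The difference of \<open>C'\<close> and \<open>K\<^sup>* y\<close> lies in the kernel of \<open>K\<close>, which is orthogonal to \<open>K\<^sup>* y\<close>.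
\<close>

lemma norm2_le_of_range_adjoint:
  assumes K: "K \<in> carrier_mat n p" and y: "y \<in> carrier_vec n" and C': "C' \<in> carrier_vec p"
    and eq: "K *\<^sub>v C' = K *\<^sub>v (mat_adjoint K *\<^sub>v y)"
  shows "norm2 (mat_adjoint K *\<^sub>v y) \<le> norm2 C'"
proof -
  define C where "C = mat_adjoint K *\<^sub>v y"
  define w where "w = C' - C"
  have C: "C \<in> carrier_vec p" unfolding C_def using K y by (meson mat_adjoint_carrier mult_mat_vec_carrier)
  have w: "w \<in> carrier_vec p" using C C' unfolding w_def by auto
  have Kw: "K *\<^sub>v w = 0\<^sub>v n"
    using K C C' eq unfolding w_def C_def[symmetric] by (simp add: mult_minus_distrib_mat_vec)
  have "w \<bullet>c C = (K *\<^sub>v w) \<bullet>c y"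
    unfolding C_def using cscalar_prod_adjoint[OF K w y] by simp
  then have "w \<bullet>c C = 0" using Kw y by simp
  moreover have "C' = w + C" using C C' unfolding w_def by auto
  ultimately have "(norm2 C')\<^sup>2 = (norm2 w)\<^sup>2 + (norm2 C)\<^sup>2"
    using norm2_sq_add[OF w C] by simp
  then have "(norm2 C)\<^sup>2 \<le> (norm2 C')\<^sup>2" by simp
  then show ?thesis unfolding C_def using norm2_nonneg power2_le_imp_le by blast
qed

text \<open>
  Expanding the cost at \<open>C + w\<close>, the terms linear in \<open>w\<close> are the inner product of \<open>w\<close> with the
  gradient at \<open>C\<close>, which is zero by the normal equations. The quadratic terms
  \<open>\<parallel>K w\<parallel>\<^sup>2 + \<parallel>E w\<parallel>\<^sup>2\<close> are nonnegative.
\<close>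

lemma regularized_least_squares_minimum:
  assumes K: "K \<in> carrier_mat n p" and E: "E \<in> carrier_mat e p"
    and D: "D \<in> carrier_vec n" and C: "C \<in> carrier_vec p" and C': "C' \<in> carrier_vec p"
    and normal: "(mat_adjoint K * K + mat_adjoint E * E) *\<^sub>v C = mat_adjoint K *\<^sub>v D"
  shows "(norm2 (D - K *\<^sub>v C))\<^sup>2 + (norm2 (E *\<^sub>v C))\<^sup>2
    \<le> (norm2 (D - K *\<^sub>v C'))\<^sup>2 + (norm2 (E *\<^sub>v C'))\<^sup>2"
proof -
  define w where "w = C' - C"
  define R where "R = D - K *\<^sub>v C"
  have w: "w \<in> carrier_vec p" using C C' unfolding w_def by auto
  have R: "R \<in> carrier_vec n" unfolding R_def using K C D by auto
  note Ka = mat_adjoint_carrier[OF K] and Ea = mat_adjoint_carrier[OF E]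
  have C'w: "C' = C + w" using C C' unfolding w_def by auto
  have Kw: "K *\<^sub>v w \<in> carrier_vec n" and KC: "K *\<^sub>v C \<in> carrier_vec n"
    and Ew: "E *\<^sub>v w \<in> carrier_vec e" and EC: "E *\<^sub>v C \<in> carrier_vec e"
    using K E C w by auto
  have res: "D - K *\<^sub>v C' = - (K *\<^sub>v w) + R"
    unfolding C'w mult_add_distrib_mat_vec[OF K C w] R_def using D Kw KC by (intro eq_vecI) auto
  have EC': "E *\<^sub>v C' = E *\<^sub>v w + E *\<^sub>v C"
    unfolding C'w mult_add_distrib_mat_vec[OF E C w] using Ew EC by (intro eq_vecI) auto
  \<comment> \<open>The normal equations in terms of the residual: the two linear terms cancel.\<close>
  have cancel: "u + v - u = v" if "u \<in> carrier_vec p" "v \<in> carrier_vec p" for u v :: "complex vec"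
    using that by (intro eq_vecI) auto
  have "mat_adjoint K *\<^sub>v R = mat_adjoint K *\<^sub>v D - mat_adjoint K *\<^sub>v (K *\<^sub>v C)"
    unfolding R_def using Ka D KC by (simp add: mult_minus_distrib_mat_vec)
  also have "mat_adjoint K *\<^sub>v D = (mat_adjoint K * K) *\<^sub>v C + (mat_adjoint E * E) *\<^sub>v C"
    unfolding normal[symmetric]
    by (rule add_mult_distrib_mat_vec[OF mult_carrier_mat[OF Ka K] mult_carrier_mat[OF Ea E] C])
  also have "\<dots> = mat_adjoint K *\<^sub>v (K *\<^sub>v C) + mat_adjoint E *\<^sub>v (E *\<^sub>v C)"
    unfolding assoc_mult_mat_vec[OF Ka K C] assoc_mult_mat_vec[OF Ea E C] ..
  also have "\<dots> - mat_adjoint K *\<^sub>v (K *\<^sub>v C) = mat_adjoint E *\<^sub>v (E *\<^sub>v C)"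
    by (rule cancel[OF mult_mat_vec_carrier[OF Ka KC] mult_mat_vec_carrier[OF Ea EC]])
  finally have stat: "mat_adjoint K *\<^sub>v R = mat_adjoint E *\<^sub>v (E *\<^sub>v C)" .
  have "(K *\<^sub>v w) \<bullet>c R = (E *\<^sub>v w) \<bullet>c (E *\<^sub>v C)"
    unfolding cscalar_prod_adjoint[OF K w R] cscalar_prod_adjoint[OF E w EC] stat ..
  moreover have "(- (K *\<^sub>v w)) \<bullet>c R = - ((K *\<^sub>v w) \<bullet>c R)"
    by (rule scalar_prod_uminus_left) (use Kw R in \<open>simp del: dim_mult_mat_vec\<close>)
  ultimately show ?thesis
    unfolding res EC' R_def[symmetric] using norm2_sq_add[OF _ R, of "- (K *\<^sub>v w)"]
      norm2_sq_add[OF Ew EC] Kw by simp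
qed

section \<open>Inverses and full row rank\<close>

lemma invertible_mat_inverse:
  assumes M: "M \<in> carrier_mat n n" and inv: "invertible_mat M"
  obtains N where "N \<in> carrier_mat n n" "M * N = 1\<^sub>m n" "N * M = 1\<^sub>m n"
proof -
  obtain N where N: "M * N = 1\<^sub>m (dim_row M)" "N * M = 1\<^sub>m (dim_row N)"
    using inv unfolding invertible_mat_def inverts_mat_def by auto
  have "dim_col N = n" using arg_cong[OF N(1), of dim_col] M by simp
  moreover have "dim_row N = n" using arg_cong[OF N(2), of dim_col] M by simp
  ultimately show ?thesis using that[of N] N M by auto
qed

lemma inv_mat_inverse:
  assumes M: "M \<in> carrier_mat n n" and inv: "invertible_mat M"
  shows "inv_mat M \<in> carrier_mat n n" "M * inv_mat M = 1\<^sub>m n" "inv_mat M * M = 1\<^sub>m n"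
proof -
  obtain N where N: "N \<in> carrier_mat n n" "M * N = 1\<^sub>m n" "N * M = 1\<^sub>m n"
    using invertible_mat_inverse[OF M inv] .
  then have "M \<in> Units (ring_mat TYPE(complex) n undefined)"
    using M unfolding Units_def ring_mat_def by auto
  then obtain L where "mat_inverse M = Some L"
    using mat_inverse(1)[OF M] by fastforce
  then show "inv_mat M \<in> carrier_mat n n" "M * inv_mat M = 1\<^sub>m n" "inv_mat M * M = 1\<^sub>m n"
    using mat_inverse(2)[OF M] unfolding inv_mat_def by auto
qed

lemma invertible_mat_of_trivial_kernel:
  fixes M :: "'a :: field mat"
  assumes M: "M \<in> carrier_mat n n"
    and ker: "\<And>v. v \<in> carrier_vec n \<Longrightarrow> M *\<^sub>v v = 0\<^sub>v n \<Longrightarrow> v = 0\<^sub>v n"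
  shows "invertible_mat M"
proof -
  have "det M \<noteq> 0" using det_0_iff_vec_prod_zero_field[OF M] ker by blast
  then have "M \<in> Units (ring_mat TYPE('a) n undefined)" by (rule det_non_zero_imp_unit[OF M])
  then show ?thesis
    using M unfolding Units_def ring_mat_def invertible_mat_def inverts_mat_def by auto
qed

text \<open>
  A maximal independent set of columns has as many elements as the rank, here the dimension of the
  whole space; it is therefore a basis, and the columns span.
\<close>

lemma full_row_rank_surjective:
  fixes K :: "'a :: field mat"
  assumes K: "K \<in> carrier_mat n p" and rank: "vec_space.rank n K = n"
    and v: "v \<in> carrier_vec n"
  obtains x where "x \<in> carrier_vec p" "K *\<^sub>v x = v"
proof -
  interpret vec_space "TYPE('a)" n .
  let ?indep = "\<lambda>T. T \<subseteq> set (cols K) \<and> lin_indpt T"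
  have cols: "set (cols K) \<subseteq> carrier_vec n" using cols_dim K by blast
  have "lin_indpt {}" by (simp add: lin_dep_def)
  then obtain S where S: "finite S" "maximal S ?indep"
    using maximal_exists_superset[of "set (cols K)" ?indep "{}"] by auto
  have sub: "S \<subseteq> set (cols K)" and li: "lin_indpt S" using S(2) unfolding maximal_def by auto
  have "card S = n" using rank_card_indpt[OF K S(2)] rank by simp
  then have "basis S"
    using S(1) sub li cols by (intro dim_li_is_basis) (auto simp: dim_is_n)
  then have "v \<in> span S" using v unfolding basis_def by auto
  then have "v \<in> col_space K" unfolding col_space_def using span_is_monotone[OF sub] by auto
  then show ?thesis using col_space_eq[OF K] K that by auto
qed

text \<open>
  If \<open>K K\<^sup>* v = 0\<close>, then \<open>\<parallel>K\<^sup>* v\<parallel>\<^sup>2 = \<langle>K K\<^sup>* v, v\<rangle> = 0\<close>, so \<open>v\<close> is orthogonal to the range of \<open>K\<close>. This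
  range contains \<open>v\<close> itself.
\<close>

lemma gram_invertible_of_full_row_rank:
  fixes K :: "complex mat"
  assumes K: "K \<in> carrier_mat n p" and rank: "vec_space.rank n K = n"
  shows "invertible_mat (K * mat_adjoint K)"
proof (rule invertible_mat_of_trivial_kernel)
  note Ka = mat_adjoint_carrier[OF K]
  show "K * mat_adjoint K \<in> carrier_mat n n" using K Ka by auto
  fix v assume v: "v \<in> carrier_vec n" and "(K * mat_adjoint K) *\<^sub>v v = 0\<^sub>v n"
  define u where "u = mat_adjoint K *\<^sub>v v"
  have u: "u \<in> carrier_vec p" unfolding u_def using Ka v by auto
  have "K *\<^sub>v u = 0\<^sub>v n"
    using \<open>(K * mat_adjoint K) *\<^sub>v v = 0\<^sub>v n\<close> assoc_mult_mat_vec[OF K Ka v] unfolding u_def by simp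
  then have "u \<bullet>c u = 0"
    using cscalar_prod_adjoint[OF K u v] v unfolding u_def[symmetric] by simp
  then have u0: "u = 0\<^sub>v p" using u by simp
  obtain x where x: "x \<in> carrier_vec p" "K *\<^sub>v x = v"
    using full_row_rank_surjective[OF K rank v] .
  have "v \<bullet>c v = x \<bullet>c u"
    using cscalar_prod_adjoint[OF K x(1) v] x(2) unfolding u_def by simp
  then have "v \<bullet>c v = 0" using u0 x(1) by simp
  then show "v = 0\<^sub>v n" using v by simp
qed

section \<open>Pencils whose forward solutions vanish\<close>

text \<open>
  The equality of the dimensions is part of the notion: it lets a solution of a block diagonal sum
  be cut into solutions of the summands, also where a block is empty in one direction.
\<close>

definition zero_solutions_only :: "'a :: field mat \<Rightarrow> 'a mat \<Rightarrow> bool" where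
  "zero_solutions_only M N \<longleftrightarrow>
     dim_row M = dim_row N \<and> dim_col M = dim_col N \<and>
     (\<forall>z. (\<forall>k. z k \<in> carrier_vec (dim_col M)) \<and> (\<forall>k. M *\<^sub>v z (Suc k) = N *\<^sub>v z k)
        \<longrightarrow> (\<forall>k. z k = 0\<^sub>v (dim_col M)))"

lemma zero_mat_mult_vec:
  fixes v :: "'a :: semiring_0 vec"
  assumes "v \<in> carrier_vec c"
  shows "0\<^sub>m r c *\<^sub>v v = 0\<^sub>v r"
  using assms by (intro eq_vecI) auto

lemma diag_block_two_mult_vec:
  fixes A :: "'a :: field mat"
  assumes A: "A \<in> carrier_mat r1 c1" and B: "B \<in> carrier_mat r2 c2"
    and a: "a \<in> carrier_vec c1" and b: "b \<in> carrier_vec c2"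
  shows "four_block_mat A (0\<^sub>m r1 c2) (0\<^sub>m r2 c1) B *\<^sub>v (a @\<^sub>v b) = A *\<^sub>v a @\<^sub>v B *\<^sub>v b"
  unfolding four_block_mat_mult_vec[OF A zero_carrier_mat zero_carrier_mat B a b]
    zero_mat_mult_vec[OF a] zero_mat_mult_vec[OF b]
  using mult_mat_vec_carrier[OF A a] mult_mat_vec_carrier[OF B b] by simp

lemma zero_solutions_only_Cons:
  assumes M: "zero_solutions_only M N"
    and Ms: "zero_solutions_only (diag_block_mat Ms) (diag_block_mat Ns)"
  shows "zero_solutions_only (diag_block_mat (M # Ms)) (diag_block_mat (N # Ns))"
proof -
  define M' N' where "M' = diag_block_mat Ms" and "N' = diag_block_mat Ns"
  obtain r1 c1 r2 c2 where car: "M \<in> carrier_mat r1 c1" "N \<in> carrier_mat r1 c1"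
    "M' \<in> carrier_mat r2 c2" "N' \<in> carrier_mat r2 c2"
    using M Ms unfolding zero_solutions_only_def M'_def N'_def carrier_mat_def by auto
  let ?M = "four_block_mat M (0\<^sub>m r1 c2) (0\<^sub>m r2 c1) M'"
  let ?N = "four_block_mat N (0\<^sub>m r1 c2) (0\<^sub>m r2 c1) N'"
  have eqs: "diag_block_mat (M # Ms) = ?M" "diag_block_mat (N # Ns) = ?N"
    using car unfolding M'_def N'_def by (simp_all add: Let_def)
  have "\<forall>k. z k = 0\<^sub>v (c1 + c2)"
    if z: "\<forall>k. z k \<in> carrier_vec (c1 + c2)" and rec: "\<forall>k. ?M *\<^sub>v z (Suc k) = ?N *\<^sub>v z k" for z
  proof -
    define a where "a k = vec_first (z k) c1" for k
    define b where "b k = vec_last (z k) c2" for k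
    have ab: "z k = a k @\<^sub>v b k" for k using z unfolding a_def b_def by simp
    have a: "a k \<in> carrier_vec c1" and b: "b k \<in> carrier_vec c2" for k
      unfolding a_def b_def by auto
    have "M *\<^sub>v a (Suc k) @\<^sub>v M' *\<^sub>v b (Suc k) = N *\<^sub>v a k @\<^sub>v N' *\<^sub>v b k" for k
      using rec[rule_format, of k] unfolding ab
      by (simp add: diag_block_two_mult_vec car a b)
    then have "M *\<^sub>v a (Suc k) = N *\<^sub>v a k \<and> M' *\<^sub>v b (Suc k) = N' *\<^sub>v b k" for k
      using append_vec_eq[of _ r1] car a b by (metis mult_mat_vec_carrier)
    then have "a k = 0\<^sub>v c1 \<and> b k = 0\<^sub>v c2" for k
      using M Ms a b car unfolding zero_solutions_only_def M'_def[symmetric] N'_def[symmetric]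
      by auto
    then show ?thesis unfolding ab by auto
  qed
  then show ?thesis
    unfolding eqs zero_solutions_only_def using car by auto
qed

lemma zero_solutions_only_no_columns:
  "zero_solutions_only (0\<^sub>m h 0) (0\<^sub>m h 0 :: 'a :: field mat)"
proof -
  have "v = 0\<^sub>v 0" if "v \<in> carrier_vec 0" for v :: "'a vec"
    using that by (intro eq_vecI) auto
  then show ?thesis unfolding zero_solutions_only_def by (metis index_zero_mat(2,3))
qed

lemma zero_solutions_only_diag:
  "list_all2 zero_solutions_only Ms Ns \<Longrightarrow>
    zero_solutions_only (diag_block_mat Ms) (diag_block_mat Ns)"
proof (induction rule: list_all2_induct)
  case Nil
  show ?case using zero_solutions_only_no_columns[of 0] by simp
next
  case (Cons M Ms N Ns)
  then show ?case by (intro zero_solutions_only_Cons) auto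
qed

text \<open>
  The recursion that nilpotent Jordan blocks and row minimal index blocks have in common. An entry
  equals its right neighbour one time step later, so after finitely many steps it is found at the
  right end of the block, where it is zero.
\<close>

lemma delayed_shift_vanishes:
  fixes x :: "nat \<Rightarrow> nat \<Rightarrow> 'a :: zero"
  assumes shift: "\<And>k i. i < n \<Longrightarrow> x k i = (if Suc i < n then x (Suc k) (Suc i) else 0)"
    and "i < n"
  shows "x k i = 0"
  using \<open>i < n\<close>
proof (induction "n - i" arbitrary: k i rule: less_induct)
  case less
  show ?case
  proof (cases "Suc i < n")
    case True
    then have "x (Suc k) (Suc i) = 0" by (intro less.hyps) auto
    then show ?thesis using shift[OF less.prems, of k] True by simp
  next
    case False
    then show ?thesis using shift[OF less.prems, of k] by simp
  qed
qed

lemma zero_solutions_only_nilpotent_jordan_block: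
  "zero_solutions_only (jordan_block n 0) (1\<^sub>m n :: 'a :: field mat)"
  unfolding zero_solutions_only_def
proof (intro conjI allI impI)
  fix z :: "nat \<Rightarrow> 'a vec" and k
  assume "(\<forall>k. z k \<in> carrier_vec (dim_col (jordan_block n (0 :: 'a)))) \<and>
    (\<forall>k. jordan_block n 0 *\<^sub>v z (Suc k) = 1\<^sub>m n *\<^sub>v z k)"
  then have z: "\<And>k. z k \<in> carrier_vec n"
    and rec: "\<And>k. jordan_block n 0 *\<^sub>v z (Suc k) = z k" by auto
  have "z k $ i = (if Suc i < n then z (Suc k) $ Suc i else 0)" if i: "i < n" for k i
  proof -
    have "z k $ i = (\<Sum>j<n. jordan_block n 0 $$ (i, j) * z (Suc k) $ j)"
      unfolding rec[of k, symmetric] using i z[of "Suc k"]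
      by (simp add: scalar_prod_def atLeast0LessThan)
    also have "\<dots> = (\<Sum>j<n. if j = Suc i then z (Suc k) $ j else 0)"
      using i by (intro sum.cong) auto
    finally show ?thesis by simp
  qed
  then have "z k $ i = 0" if "i < n" for i
    using that by (rule delayed_shift_vanishes[where x = "\<lambda>k i. z k $ i"])
  then show "z k = 0\<^sub>v (dim_col (jordan_block n (0 :: 'a)))"
    using z[of k] by (intro eq_vecI) auto
qed auto

text \<open>
  The equation says that \<open>z (k + 1)\<close> followed by a zero is a zero followed by \<open>z k\<close>: up to the
  extra condition that the first entry of \<open>z (k + 1)\<close> vanishes, this is the same recursion as for
  a nilpotent Jordan block.
\<close>

lemma zero_solutions_only_row_minimal_index:
  "zero_solutions_only (1\<^sub>m n @\<^sub>r 0\<^sub>m 1 n) (0\<^sub>m 1 n @\<^sub>r 1\<^sub>m n :: 'a :: field mat)"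
proof -
  have car: "(1\<^sub>m n @\<^sub>r 0\<^sub>m 1 n :: 'a mat) \<in> carrier_mat (n + 1) n"
    "(0\<^sub>m 1 n @\<^sub>r 1\<^sub>m n :: 'a mat) \<in> carrier_mat (1 + n) n"
    by (rule carrier_append_rows; simp)+
  have "z k = 0\<^sub>v n"
    if z: "\<And>k. z k \<in> carrier_vec n"
      and rec: "\<And>k. (1\<^sub>m n @\<^sub>r 0\<^sub>m 1 n) *\<^sub>v z (Suc k) = (0\<^sub>m 1 n @\<^sub>r 1\<^sub>m n) *\<^sub>v z k"
    for z :: "nat \<Rightarrow> 'a vec" and k
  proof -
    have app: "z (Suc k) @\<^sub>v 0\<^sub>v 1 = 0\<^sub>v 1 @\<^sub>v z k" for k
      using rec[of k] z mat_mult_append[of "1\<^sub>m n" n n "0\<^sub>m 1 n" 1 "z (Suc k)"]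
        mat_mult_append[of "0\<^sub>m 1 n" 1 n "1\<^sub>m n" n "z k"]
      by (simp add: zero_mat_mult_vec)
    have "z k $ i = (if Suc i < n then z (Suc k) $ Suc i else 0)" if i: "i < n" for k i
      using arg_cong[OF app[of k], of "\<lambda>v. v $ Suc i"] z[of k] z[of "Suc k"] i
      by (auto split: if_splits)
    then have "z k $ i = 0" if "i < n" for i
      using that by (rule delayed_shift_vanishes[where x = "\<lambda>k i. z k $ i"])
    then show ?thesis using z[of k] by (intro eq_vecI) auto
  qed
  then show ?thesis unfolding zero_solutions_only_def using car by auto
qed

lemma one_mat_diag: "(1\<^sub>m (sum_list ns) :: 'a :: {zero, one} mat) = diag_block_mat (map 1\<^sub>m ns)"
proof -
  have "diag_block_mat (map (\<lambda>A. 1\<^sub>m (dim_row A)) (map 1\<^sub>m ns :: 'a mat list))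
      = (1\<^sub>m (sum_list (map dim_row (map 1\<^sub>m ns :: 'a mat list))) :: 'a mat)"
    by (rule diag_block_one_mat)
  then show ?thesis by (simp add: o_def del: diag_block_one_mat)
qed

lemma zero_solutions_only_nilpotent_jordan:
  "zero_solutions_only (jordan_matrix (map (\<lambda>k. (k, 0)) qs)) (1\<^sub>m (sum_list qs) :: 'a :: field mat)"
  unfolding one_mat_diag jordan_matrix_def
  by (rule zero_solutions_only_diag)
    (auto simp: list_all2_map1 list_all2_map2 list_all2_same
      zero_solutions_only_nilpotent_jordan_block)

lemma zero_solutions_only_F_G_zeta: "zero_solutions_only (F_zeta zs) (G_zeta zs)"
  unfolding F_zeta_def G_zeta_def
  by (rule zero_solutions_only_diag)
    (auto simp: list_all2_map1 list_all2_map2 list_all2_same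
      intro: zero_solutions_only_row_minimal_index[simplified])

section \<open>Solutions of the system and of the boundary value problem\<close>

lemma pow_mat_Suc_left:
  fixes J :: "'a :: semiring_1 mat"
  assumes J: "J \<in> carrier_mat p p"
  shows "J ^\<^sub>m Suc k = J * J ^\<^sub>m k"
proof (induction k)
  case 0
  then show ?case using J by simp
next
  case (Suc k)
  have "J ^\<^sub>m Suc (Suc k) = (J * J ^\<^sub>m k) * J" using Suc by simp
  also have "\<dots> = J * (J ^\<^sub>m k * J)" using J by (intro assoc_mult_mat) auto
  finally show ?case by simp
qed

lemma first_cols_carrier [simp]: "Q \<in> carrier_mat m n \<Longrightarrow> first_cols p Q \<in> carrier_mat m p"
  unfolding first_cols_def by auto

lemma first_cols_mult_vec:
  fixes Q :: "'a :: semiring_1 mat"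
  assumes Q: "Q \<in> carrier_mat m (p + c)" and x: "x \<in> carrier_vec p"
  shows "first_cols p Q *\<^sub>v x = Q *\<^sub>v (x @\<^sub>v 0\<^sub>v c)"
proof (rule eq_vecI)
  show "dim_vec (first_cols p Q *\<^sub>v x) = dim_vec (Q *\<^sub>v (x @\<^sub>v 0\<^sub>v c))"
    unfolding first_cols_def by simp
  fix i assume "i < dim_vec (Q *\<^sub>v (x @\<^sub>v 0\<^sub>v c))"
  then have i: "i < m" using Q by simp
  have "(Q *\<^sub>v (x @\<^sub>v 0\<^sub>v c)) $ i = (\<Sum>j<p + c. Q $$ (i, j) * (x @\<^sub>v 0\<^sub>v c) $ j)"
    using Q x i by (simp add: scalar_prod_def atLeast0LessThan)
  also have "\<dots> = (\<Sum>j<p. Q $$ (i, j) * x $ j)"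
    using x by (intro sum.mono_neutral_cong_right) auto
  also have "\<dots> = (first_cols p Q *\<^sub>v x) $ i"
    using Q x i unfolding first_cols_def by (simp add: scalar_prod_def atLeast0LessThan)
  finally show "(first_cols p Q *\<^sub>v x) $ i = (Q *\<^sub>v (x @\<^sub>v 0\<^sub>v c)) $ i" by simp
qed

text \<open>
  In the coordinates \<open>Q\<^sup>-\<^sup>1 Y\<^sub>k = (a\<^sub>k, b\<^sub>k)\<close> the system separates into \<open>a\<^sub>k\<^sub>+\<^sub>1 = J a\<^sub>k\<close> and the
  recursion of the remaining blocks for \<open>b\<^sub>k\<close>, which has only the zero solution. Multiplication by
  \<open>Q\<close> of a vector whose second part is zero uses the first columns of \<open>Q\<close> only.
\<close>

lemma system_solutions_eq_trajectories:
  assumes F: "F \<in> carrier_mat r m" and G: "G \<in> carrier_mat r m"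
    and P: "P \<in> carrier_mat r r" "invertible_mat P"
    and Q: "Q \<in> carrier_mat m m" "invertible_mat Q"
    and J: "J \<in> carrier_mat p p"
    and PFQ: "P * F * Q = diag_block_mat (1\<^sub>m p # Ms)"
    and PGQ: "P * G * Q = diag_block_mat (J # Ns)"
    and rest: "zero_solutions_only (diag_block_mat Ms) (diag_block_mat Ns)"
  shows "system_solutions F G k0 = trajectory (first_cols p Q) J k0 ` carrier_vec p"
proof -
  define M N where "M = diag_block_mat Ms" and "N = diag_block_mat Ns"
  obtain r' c where M: "M \<in> carrier_mat r' c" and N: "N \<in> carrier_mat r' c"
    using rest unfolding zero_solutions_only_def M_def N_def carrier_mat_def by auto
  have PFQ': "P * F * Q = four_block_mat (1\<^sub>m p) (0\<^sub>m p c) (0\<^sub>m r' p) M"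
    and PGQ': "P * G * Q = four_block_mat J (0\<^sub>m p c) (0\<^sub>m r' p) N"
    using M N J PFQ PGQ unfolding M_def N_def by (simp_all add: Let_def)
  have mc: "m = p + c" using arg_cong[OF PFQ', of dim_col] Q M by simp
  obtain Pi where Pi: "Pi \<in> carrier_mat r r" "Pi * P = 1\<^sub>m r"
    using invertible_mat_inverse[OF P] by metis
  obtain Qi where Qi: "Qi \<in> carrier_mat m m" "Q * Qi = 1\<^sub>m m"
    using invertible_mat_inverse[OF Q] by metis
  let ?Qp = "first_cols p Q"
  have Qp: "?Qp \<in> carrier_mat m p" using Q(1) by simp
  have Jk: "J ^\<^sub>m k \<in> carrier_mat p p" for k using J by simp
  have traj: "trajectory ?Qp J k0 C k = Q *\<^sub>v (J ^\<^sub>m (k - k0) *\<^sub>v C @\<^sub>v 0\<^sub>v c)"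
    if "C \<in> carrier_vec p" "k \<ge> k0" for C k
  proof -
    have "trajectory ?Qp J k0 C k = ?Qp *\<^sub>v (J ^\<^sub>m (k - k0) *\<^sub>v C)"
      using that assoc_mult_mat_vec[OF Qp Jk] unfolding trajectory_def by simp
    also have "\<dots> = Q *\<^sub>v (J ^\<^sub>m (k - k0) *\<^sub>v C @\<^sub>v 0\<^sub>v c)"
      using Q(1) mc by (intro first_cols_mult_vec mult_mat_vec_carrier[OF Jk that(1)]) auto
    finally show ?thesis .
  qed
  have PF: "P *\<^sub>v (F *\<^sub>v (Q *\<^sub>v (a @\<^sub>v b))) = a @\<^sub>v M *\<^sub>v b"
    and PG: "P *\<^sub>v (G *\<^sub>v (Q *\<^sub>v (a @\<^sub>v b))) = J *\<^sub>v a @\<^sub>v N *\<^sub>v b"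
    if a: "a \<in> carrier_vec p" and b: "b \<in> carrier_vec c" for a b
  proof -
    have ab: "a @\<^sub>v b \<in> carrier_vec m" using a b mc by auto
    have "P *\<^sub>v (X *\<^sub>v (Q *\<^sub>v (a @\<^sub>v b))) = (P * X * Q) *\<^sub>v (a @\<^sub>v b)"
      if X: "X \<in> carrier_mat r m" for X
    proof -
      have "P * X \<in> carrier_mat r m" "Q *\<^sub>v (a @\<^sub>v b) \<in> carrier_vec m" using P(1) X Q(1) ab by auto
      then show ?thesis
        using assoc_mult_mat_vec[OF _ Q(1) ab] assoc_mult_mat_vec[OF P(1) X] by simp
    qed
    then show "P *\<^sub>v (F *\<^sub>v (Q *\<^sub>v (a @\<^sub>v b))) = a @\<^sub>v M *\<^sub>v b"
      "P *\<^sub>v (G *\<^sub>v (Q *\<^sub>v (a @\<^sub>v b))) = J *\<^sub>v a @\<^sub>v N *\<^sub>v b"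
      using F G PFQ' PGQ' diag_block_two_mult_vec[OF _ M a b, of "1\<^sub>m p" p]
        diag_block_two_mult_vec[OF J N a b] a by auto
  qed
  show ?thesis
  proof (intro Set.set_eqI iffI)
    fix Y assume Y: "Y \<in> system_solutions F G k0"
    then have Yc: "\<And>k. k \<ge> k0 \<Longrightarrow> Y k \<in> carrier_vec m"
      and FG: "\<And>k. k \<ge> k0 \<Longrightarrow> F *\<^sub>v Y (Suc k) = G *\<^sub>v Y k"
      using F unfolding system_solutions_def by auto
    define z where "z j = Qi *\<^sub>v Y (k0 + j)" for j
    define a where "a j = vec_first (z j) p" for j
    define b where "b j = vec_last (z j) c" for j
    have zc: "z j \<in> carrier_vec (p + c)" for j
      using Qi(1) Yc[of "k0 + j"] mc unfolding z_def by auto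
    have ab: "z j = a j @\<^sub>v b j" for j using zc[of j] unfolding a_def b_def by simp
    have a: "a j \<in> carrier_vec p" and b: "b j \<in> carrier_vec c" for j
      unfolding a_def b_def by auto
    have Yz: "Y (k0 + j) = Q *\<^sub>v (a j @\<^sub>v b j)" for j
      unfolding ab[symmetric] z_def using assoc_mult_mat_vec[OF Q(1) Qi(1) Yc, symmetric] Qi(2) Yc
      by simp
    have "P *\<^sub>v (F *\<^sub>v Y (k0 + Suc j)) = P *\<^sub>v (G *\<^sub>v Y (k0 + j))" for j
      using FG[of "k0 + j"] by simp
    then have "a (Suc j) @\<^sub>v M *\<^sub>v b (Suc j) = J *\<^sub>v a j @\<^sub>v N *\<^sub>v b j" for j
      unfolding Yz by (simp add: PF PG a b)
    then have step: "a (Suc j) = J *\<^sub>v a j \<and> M *\<^sub>v b (Suc j) = N *\<^sub>v b j" for j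
      using append_vec_eq[of _ p] a J by (metis mult_mat_vec_carrier)
    have b0: "b j = 0\<^sub>v c" for j
      using rest step b M unfolding zero_solutions_only_def M_def[symmetric] N_def[symmetric] by auto
    have aj: "a j = J ^\<^sub>m j *\<^sub>v a 0" for j
    proof (induction j)
      case 0
      then show ?case using a[of 0] J by simp
    next
      case (Suc j)
      then show ?case
        using step[of j] pow_mat_Suc_left[OF J, of j] assoc_mult_mat_vec[OF J Jk a] by simp
    qed
    have "Y k = trajectory ?Qp J k0 (a 0) k" for k
    proof (cases "k \<ge> k0")
      case True
      then show ?thesis using Yz[of "k - k0"] b0 aj[of "k - k0"] traj[OF a True] by simp
    next
      case False
      then show ?thesis
        using Y unfolding system_solutions_def trajectory_def by (auto simp: PiE_def extensional_def)
    qed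
    then show "Y \<in> trajectory ?Qp J k0 ` carrier_vec p" using a[of 0] by blast
  next
    fix Y assume "Y \<in> trajectory ?Qp J k0 ` carrier_vec p"
    then obtain C where C: "C \<in> carrier_vec p" and Y: "Y = trajectory ?Qp J k0 C" by auto
    have Yc: "Y k \<in> carrier_vec m" if "k \<ge> k0" for k
      unfolding Y traj[OF C that] mc
      by (rule mult_mat_vec_carrier[OF Q(1)[unfolded mc]
            append_carrier_vec[OF mult_mat_vec_carrier[OF Jk C] zero_carrier_vec]])
    have "F *\<^sub>v Y (Suc k) = G *\<^sub>v Y k" if k: "k \<ge> k0" for k
    proof -
      let ?a = "J ^\<^sub>m (k - k0) *\<^sub>v C"
      have a: "?a \<in> carrier_vec p" "J *\<^sub>v ?a \<in> carrier_vec p"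
        by (rule mult_mat_vec_carrier[OF Jk C],
            rule mult_mat_vec_carrier[OF J mult_mat_vec_carrier[OF Jk C]])
      have MN0: "M *\<^sub>v 0\<^sub>v c = N *\<^sub>v 0\<^sub>v c"
        using M N by (auto intro!: eq_vecI simp: scalar_prod_def)
      have FY: "F *\<^sub>v Y (Suc k) \<in> carrier_vec r" and GY: "G *\<^sub>v Y k \<in> carrier_vec r"
        using mult_mat_vec_carrier[OF F Yc] mult_mat_vec_carrier[OF G Yc] k by auto
      have "J ^\<^sub>m (Suc k - k0) *\<^sub>v C = J *\<^sub>v ?a"
        using k pow_mat_Suc_left[OF J] assoc_mult_mat_vec[OF J Jk C] by (simp add: Suc_diff_le del: pow_mat.simps)
      then have YS: "Y (Suc k) = Q *\<^sub>v (J *\<^sub>v ?a @\<^sub>v 0\<^sub>v c)" unfolding Y using traj[OF C, of "Suc k"] k by simp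
      have "P *\<^sub>v (F *\<^sub>v Y (Suc k)) = P *\<^sub>v (G *\<^sub>v Y k)"
        unfolding YS unfolding Y traj[OF C k] using a MN0 by (simp add: PF PG)
      then have "(Pi * P) *\<^sub>v (F *\<^sub>v Y (Suc k)) = (Pi * P) *\<^sub>v (G *\<^sub>v Y k)"
        unfolding assoc_mult_mat_vec[OF Pi(1) P(1) FY] assoc_mult_mat_vec[OF Pi(1) P(1) GY] by simp
      then show ?thesis using FY GY unfolding Pi(2) by simp
    qed
    then show "Y \<in> system_solutions F G k0"
      using Yc F unfolding system_solutions_def Y trajectory_def by auto
  qed
qed

lemma kronecker_form_solutions:
  assumes F: "F \<in> carrier_mat r m" and G: "G \<in> carrier_mat r m"
    and kf: "kronecker_form F G P Q js qs zs h"
  shows "system_solutions F G k0 =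
    trajectory (first_cols (sum_list (map fst js)) Q) (jordan_matrix js) k0
      ` carrier_vec (sum_list (map fst js))"
proof (rule system_solutions_eq_trajectories[OF F G])
  let ?Ms = "[jordan_matrix (map (\<lambda>k. (k, 0)) qs), F_zeta zs, 0\<^sub>m h 0]"
  let ?Ns = "[1\<^sub>m (sum_list qs), G_zeta zs, 0\<^sub>m h 0]"
  show "zero_solutions_only (diag_block_mat ?Ms) (diag_block_mat ?Ns)"
    by (rule zero_solutions_only_diag)
      (simp add: zero_solutions_only_nilpotent_jordan zero_solutions_only_F_G_zeta
        zero_solutions_only_no_columns)
  show "P * F * Q = diag_block_mat (1\<^sub>m (sum_list (map fst js)) # ?Ms)"
    "P * G * Q = diag_block_mat (jordan_matrix js # ?Ns)"
    using kf unfolding kronecker_form_def by auto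
qed (use F kf in \<open>auto simp: kronecker_form_def\<close>)

lemma bvp_solutions_eq_trajectories:
  assumes sys: "system_solutions F G k0 = trajectory Qp J k0 ` carrier_vec p"
    and Qp: "Qp \<in> carrier_mat m p" and J: "J \<in> carrier_mat p p"
    and A: "A \<in> carrier_mat n m" and B: "B \<in> carrier_mat n m" and k: "k0 \<le> kN"
  shows "bvp_solutions F G A B D k0 kN =
    trajectory Qp J k0 ` {C \<in> carrier_vec p. (A * Qp + B * Qp * J ^\<^sub>m (kN - k0)) *\<^sub>v C = D}"
proof -
  let ?Jd = "J ^\<^sub>m (kN - k0)"
  have "A *\<^sub>v trajectory Qp J k0 C k0 + B *\<^sub>v trajectory Qp J k0 C kN
      = (A * Qp + B * Qp * ?Jd) *\<^sub>v C" if C: "C \<in> carrier_vec p" for C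
  proof -
    have Jd: "?Jd \<in> carrier_mat p p" using J by simp
    have "trajectory Qp J k0 C k0 = Qp *\<^sub>v C"
      using Qp J C unfolding trajectory_def by simp
    moreover have "trajectory Qp J k0 C kN = (Qp * ?Jd) *\<^sub>v C"
      using k unfolding trajectory_def by simp
    moreover have "(A * Qp) *\<^sub>v C = A *\<^sub>v (Qp *\<^sub>v C)"
      by (rule assoc_mult_mat_vec[OF A Qp C])
    moreover have "(B * Qp * ?Jd) *\<^sub>v C = B *\<^sub>v ((Qp * ?Jd) *\<^sub>v C)"
      unfolding assoc_mult_mat[OF B Qp Jd]
      by (rule assoc_mult_mat_vec[OF B mult_carrier_mat[OF Qp Jd] C])
    moreover have "(A * Qp + B * Qp * ?Jd) *\<^sub>v C = (A * Qp) *\<^sub>v C + (B * Qp * ?Jd) *\<^sub>v C"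
      using A B Qp Jd by (intro add_mult_distrib_mat_vec[of _ n p]) (auto simp: C)
    ultimately show ?thesis by simp
  qed
  then show ?thesis unfolding bvp_solutions_def sys by auto
qed

text \<open>
  Optimality among sequences reduces to optimality among coefficient vectors as soon as the
  admissible sequences are known to be the trajectories of the admissible coefficients.
\<close>

lemma optimal_in_trajectoriesI:
  assumes "S = trajectory Qp Jp k0 ` {C \<in> carrier_vec (dim_col Qp). R C}"
    and "C \<in> carrier_vec (dim_col Qp)" "R C"
    and "\<And>C'. C' \<in> carrier_vec (dim_col Qp) \<Longrightarrow> R C' \<Longrightarrow> cost C \<le> cost C'"
  shows "optimal_in Qp Jp k0 cost S (trajectory Qp Jp k0 C)"
    "is_arg_min cost (\<lambda>C. C \<in> carrier_vec (dim_col Qp) \<and> R C) C"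
  using assms unfolding optimal_in_def is_arg_min_def by (auto simp: not_less)

theorem proposition3p6:
  fixes F G A B P Q Jp Qp K :: "complex mat" and D :: "complex vec"
    and r m n p k0 kN h :: nat
    and js :: "(nat \<times> complex) list" and qs zs :: "nat list"
    and \<nu> :: "complex vec \<Rightarrow> real"
  assumes "F \<in> carrier_mat r m" and "G \<in> carrier_mat r m"
    and "singular_pencil F G" and "right_null_dim F G = 0"
    and "A \<in> carrier_mat n m" and "B \<in> carrier_mat n m" and "D \<in> carrier_vec n"
    and "k0 \<le> kN"
    and "kronecker_form F G P Q js qs zs h"
    and "p = sum_list (map fst js)"
    and "Jp = jordan_matrix js" and "Qp = first_cols p Q"
    and "vec_norm_on p \<nu>" and "induced_norm \<nu> Jp < 1"
    and "K = A * Qp + B * Qp * Jp ^\<^sub>m (kN - k0)"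
    and "bvp_solutions F G A B D k0 kN \<noteq> {}"
    and "infinite (bvp_solutions F G A B D k0 kN)"
  shows
    "(\<forall>Kd. moore_penrose K Kd \<longrightarrow>
        (let C = Kd *\<^sub>v D in
          optimal_in Qp Jp k0 norm2 (bvp_solutions F G A B D k0 kN) (trajectory Qp Jp k0 C) \<and>
          is_arg_min norm2 (\<lambda>C. C \<in> carrier_vec p \<and> K *\<^sub>v C = D) C)) \<and>
     (p > n \<and> vec_space.rank n K = min n p \<longrightarrow>
        invertible_mat (K * mat_adjoint K) \<and>
        (let C = (mat_adjoint K * inv_mat (K * mat_adjoint K)) *\<^sub>v D in
          optimal_in Qp Jp k0 (\<lambda>C. (norm2 C)\<^sup>2) (bvp_solutions F G A B D k0 kN)
            (trajectory Qp Jp k0 C) \<and>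
          is_arg_min (\<lambda>C. (norm2 C)\<^sup>2) (\<lambda>C. C \<in> carrier_vec p \<and> K *\<^sub>v C = D) C)) \<and>
     (\<forall>e E \<theta>. D \<in> vec_space.col_space n K \<and> vec_space.rank n K < min n p \<and>
        E \<in> carrier_mat e p \<and> invertible_mat (mat_adjoint K * K + mat_adjoint E * E) \<and>
        induced_norm norm2 E = \<theta> \<and> 0 < \<theta> \<and> \<theta> < 1 \<longrightarrow>
        (let C = (inv_mat (mat_adjoint K * K + mat_adjoint E * E) * mat_adjoint K) *\<^sub>v D;
             cost = (\<lambda>C. (norm2 (D - K *\<^sub>v C))\<^sup>2 + (norm2 (E *\<^sub>v C))\<^sup>2) in
          optimal_in Qp Jp k0 cost (system_solutions F G k0) (trajectory Qp Jp k0 C) \<and>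
          is_arg_min cost (\<lambda>C. C \<in> carrier_vec p) C))"
proof -
  note F = assms(1) and G = assms(2) and A = assms(5) and B = assms(6) and D = assms(7)
    and k = assms(8) and kf = assms(9) and p = assms(10) and Jp = assms(11) and Qp = assms(12)
    and Kdef = assms(15)
  have Jpc: "Jp \<in> carrier_mat p p" unfolding Jp p by simp
  have Qpc: "Qp \<in> carrier_mat m p" using kf F unfolding Qp kronecker_form_def by auto
  have dimQ: "dim_col Qp = p" using Qpc by simp
  have K: "K \<in> carrier_mat n p" unfolding Kdef using A B Qpc Jpc by auto
  note Ka = mat_adjoint_carrier[OF K]
  have sys: "system_solutions F G k0 = trajectory Qp Jp k0 ` carrier_vec p"
    using kronecker_form_solutions[OF F G kf] unfolding Qp Jp p .
  have bvp: "bvp_solutions F G A B D k0 kN =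
      trajectory Qp Jp k0 ` {C \<in> carrier_vec (dim_col Qp). K *\<^sub>v C = D}"
    unfolding dimQ Kdef by (rule bvp_solutions_eq_trajectories[OF sys Qpc Jpc A B k])
  obtain C0 where C0: "C0 \<in> carrier_vec p" "K *\<^sub>v C0 = D"
    using assms(16) unfolding bvp dimQ by auto
  have min: "norm2 C \<le> norm2 C'"
    if "C = mat_adjoint K *\<^sub>v y" "y \<in> carrier_vec n" "K *\<^sub>v C = D"
      "C' \<in> carrier_vec p" "K *\<^sub>v C' = D" for C C' y
    using norm2_le_of_range_adjoint[OF K that(2,4)] that by simp
  \<comment> \<open>With \<open>C = K\<^sup>\<dagger> D\<close>, the Penrose equations give
    \<open>C = K\<^sup>\<dagger> K C = (K\<^sup>\<dagger> K)\<^sup>* C = K\<^sup>* (K\<^sup>\<dagger>\<^sup>* C)\<close>, which lies in the range of \<open>K\<^sup>*\<close>.\<close>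
  have a: "optimal_in Qp Jp k0 norm2 (bvp_solutions F G A B D k0 kN) (trajectory Qp Jp k0 (Kd *\<^sub>v D)) \<and>
      is_arg_min norm2 (\<lambda>C. C \<in> carrier_vec p \<and> K *\<^sub>v C = D) (Kd *\<^sub>v D)"
    if mp: "moore_penrose K Kd" for Kd
  proof -
    have Kd: "Kd \<in> carrier_mat p n" and KKdK: "K * Kd * K = K"
      and herm: "mat_adjoint (Kd * K) = Kd * K"
      using mp K unfolding moore_penrose_def by auto
    define C where "C = Kd *\<^sub>v D"
    have C: "C \<in> carrier_vec p" unfolding C_def using Kd D by auto
    \<comment> \<open>Solvability of \<open>K C = D\<close> enters here: \<open>K K\<^sup>\<dagger>\<close> fixes the range of \<open>K\<close>.\<close>
    have "K *\<^sub>v C = (K * Kd * K) *\<^sub>v C0"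
      unfolding C_def C0(2)[symmetric] using K Kd C0(1)
      by (metis assoc_mult_mat_vec mult_carrier_mat mult_mat_vec_carrier)
    then have KC: "K *\<^sub>v C = D" using KKdK C0(2) by simp
    define y where "y = mat_adjoint Kd *\<^sub>v C"
    have y: "y \<in> carrier_vec n" unfolding y_def using mat_adjoint_carrier[OF Kd] C by auto
    have "C = (Kd * K) *\<^sub>v C"
      using KC assoc_mult_mat_vec[OF Kd K C] unfolding C_def by simp
    also have "\<dots> = mat_adjoint (Kd * K) *\<^sub>v C" unfolding herm ..
    also have "mat_adjoint (Kd * K) = mat_adjoint K * mat_adjoint Kd"
      by (rule mat_adjoint_mult[OF Kd K])
    also have "\<dots> *\<^sub>v C = mat_adjoint K *\<^sub>v y"
      unfolding y_def by (rule assoc_mult_mat_vec[OF Ka mat_adjoint_carrier[OF Kd] C])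
    finally have "C = mat_adjoint K *\<^sub>v y" .
    then show ?thesis
      using optimal_in_trajectoriesI[OF bvp, of C norm2] min[OF _ y KC] C KC
      unfolding C_def[symmetric] dimQ by auto
  qed
  have b: "invertible_mat (K * mat_adjoint K) \<and>
      (let C = (mat_adjoint K * inv_mat (K * mat_adjoint K)) *\<^sub>v D in
        optimal_in Qp Jp k0 (\<lambda>C. (norm2 C)\<^sup>2) (bvp_solutions F G A B D k0 kN)
          (trajectory Qp Jp k0 C) \<and>
        is_arg_min (\<lambda>C. (norm2 C)\<^sup>2) (\<lambda>C. C \<in> carrier_vec p \<and> K *\<^sub>v C = D) C)"
    if pn: "p > n" and rank: "vec_space.rank n K = min n p"
  proof -
    have KKc: "K * mat_adjoint K \<in> carrier_mat n n" using K Ka by auto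
    have inv: "invertible_mat (K * mat_adjoint K)"
      using gram_invertible_of_full_row_rank[OF K] pn rank by simp
    note W = inv_mat_inverse[OF KKc inv]
    define y where "y = inv_mat (K * mat_adjoint K) *\<^sub>v D"
    define C where "C = (mat_adjoint K * inv_mat (K * mat_adjoint K)) *\<^sub>v D"
    have y: "y \<in> carrier_vec n" unfolding y_def using W(1) D by auto
    have Cy: "C = mat_adjoint K *\<^sub>v y"
      unfolding C_def y_def by (rule assoc_mult_mat_vec[OF Ka W(1) D])
    have C: "C \<in> carrier_vec p" unfolding Cy using Ka y by auto
    have "K *\<^sub>v C = (K * mat_adjoint K) *\<^sub>v y"
      unfolding Cy using assoc_mult_mat_vec[OF K Ka y] by simp
    also have "\<dots> = D"
      unfolding y_def using assoc_mult_mat_vec[OF KKc W(1) D] W(2) D by simp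
    finally have KC: "K *\<^sub>v C = D" .
    have "(norm2 C)\<^sup>2 \<le> (norm2 C')\<^sup>2" if "C' \<in> carrier_vec p" "K *\<^sub>v C' = D" for C'
      using min[OF Cy y KC that] norm2_nonneg by (intro power_mono) auto
    then show ?thesis
      using optimal_in_trajectoriesI[OF bvp, of C "\<lambda>C. (norm2 C)\<^sup>2"] C KC inv
      unfolding C_def[symmetric] dimQ by auto
  qed
  have c: "let C = (inv_mat (mat_adjoint K * K + mat_adjoint E * E) * mat_adjoint K) *\<^sub>v D;
             cost = (\<lambda>C. (norm2 (D - K *\<^sub>v C))\<^sup>2 + (norm2 (E *\<^sub>v C))\<^sup>2) in
        optimal_in Qp Jp k0 cost (system_solutions F G k0) (trajectory Qp Jp k0 C) \<and>
        is_arg_min cost (\<lambda>C. C \<in> carrier_vec p) C"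
    if E: "E \<in> carrier_mat e p" and inv: "invertible_mat (mat_adjoint K * K + mat_adjoint E * E)"
    for e E
  proof -
    define M where "M = mat_adjoint K * K + mat_adjoint E * E"
    have M: "M \<in> carrier_mat p p" unfolding M_def using K Ka E mat_adjoint_carrier[OF E] by auto
    note W = inv_mat_inverse[OF M inv[folded M_def]]
    define C where "C = (inv_mat M * mat_adjoint K) *\<^sub>v D"
    have KD: "mat_adjoint K *\<^sub>v D \<in> carrier_vec p" using Ka D by auto
    have CW: "C = inv_mat M *\<^sub>v (mat_adjoint K *\<^sub>v D)"
      unfolding C_def by (rule assoc_mult_mat_vec[OF W(1) Ka D])
    have C: "C \<in> carrier_vec p" unfolding CW using W(1) KD by auto
    have "M *\<^sub>v C = mat_adjoint K *\<^sub>v D"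
      unfolding CW using assoc_mult_mat_vec[OF M W(1) KD] W(2) KD by simp
    then have "(norm2 (D - K *\<^sub>v C))\<^sup>2 + (norm2 (E *\<^sub>v C))\<^sup>2
        \<le> (norm2 (D - K *\<^sub>v C'))\<^sup>2 + (norm2 (E *\<^sub>v C'))\<^sup>2" if "C' \<in> carrier_vec p" for C'
      using regularized_least_squares_minimum[OF K E D C that] unfolding M_def by simp
    then show ?thesis
      using optimal_in_trajectoriesI[of "system_solutions F G k0" Qp Jp k0 "\<lambda>_. True" C
          "\<lambda>C. (norm2 (D - K *\<^sub>v C))\<^sup>2 + (norm2 (E *\<^sub>v C))\<^sup>2"] sys C
      unfolding M_def[symmetric] C_def[symmetric] dimQ Let_def by auto
  qed
  show ?thesis using a b c unfolding Let_def by blast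
qed

end
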